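(* Let $\theta_0<\theta_1$, $\varepsilon>0$, $\gamma\in(0,1)$ and $s>1$ be fixed, let $\nu_\theta$ be the Bernoulli distribution with natural parameter $\theta$, and consider DP-SPRT with Laplace noise, i.e. with $Y_n\sim\mathrm{Lap}(4/\varepsilon)$, $Z\sim\mathrm{Lap}(2/\varepsilon)$ and correction function $C(n,\delta)=\frac{6\log(n^s\zeta(s)/\delta)}{n\varepsilon}$. For $\beta\in(0,1)$ define $$N(\theta_0,\theta_1,\beta,\gamma)=\inf\left\{n:\frac{\log(1/(\beta\gamma))}{n|\theta_0-\theta_1|}+2C(n,(1-\gamma)\beta)\le\frac{\mathrm{KL}(\nu_{\theta_0},\nu_{\theta_1})}{2|\theta_0-\theta_1|}\right\}.$$ Then, as $\beta\to0$, $$N(\theta_0,\theta_1,\beta,\gamma)\le\frac{24(\theta_1-\theta_0)\log\left(\zeta(s)/((1-\gamma)\beta)\right)}{\varepsilon\,\mathrm{KL}(\nu_{\theta_0},\nu_{\theta_1})}+\frac{2\log(1/(\gamma\beta))}{\mathrm{KL}(\nu_{\theta_0},\nu_{\theta_1})}+o_{\beta\to0}\big(\log(1/\beta)\big).$$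
   Context: The Bernoulli distribution with natural parameter $\theta\in\mathbb{R}$ has mean $e^\theta/(1+e^\theta)$. $\mathrm{KL}$ is the Kullback–Leibler divergence, $\zeta(s)=\sum_{n\ge1}n^{-s}$ is the Riemann zeta function, $\mathrm{Lap}(b)$ is the centered Laplace distribution with scale $b$, and the infimum is over positive integers $n$. The quantity $N$ (which depends on the noise only through $C$) is the term appearing in the paper's upper bound on the expected stopping time of the DP-SPRT, a private sequential test of $\theta=\theta_0$ against $\theta=\theta_1$. *)

theory Defs
  imports "HOL-Probability.Probability" "HOL-Library.Landau_Symbols"
begin

text \<open>Riemann zeta function on real arguments \<open>s > 1\<close>; for other \<open>s\<close> the series diverges
  and the value is meaningless.\<close>

definition zeta :: "real \<Rightarrow> real" where
  "zeta s = (\<Sum>n. 1 / real (Suc n) powr s)"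

definition bernoulli_nat_param :: "real \<Rightarrow> bool pmf" where
  "bernoulli_nat_param \<theta> = bernoulli_pmf (exp \<theta> / (1 + exp \<theta>))"

text \<open>The library's \<open>KL_divergence b M N\<close> integrates \<open>log b (dN/dM)\<close> against \<open>N\<close>, so its
  reference measure comes first. Below, \<open>KL p q\<close> is the expectation under \<open>p\<close> of the natural
  logarithm of \<open>dp/dq\<close>.\<close>

definition KL :: "'a pmf \<Rightarrow> 'a pmf \<Rightarrow> real" where
  "KL p q = KL_divergence (exp 1) (measure_pmf q) (measure_pmf p)"

text \<open>Correction function of DP-SPRT for the noise \<open>Y\<^sub>n \<sim> Lap(4/\<epsilon>)\<close>, \<open>Z \<sim> Lap(2/\<epsilon>)\<close>.\<close>

definition laplace_correction :: "real \<Rightarrow> real \<Rightarrow> nat \<Rightarrow> real \<Rightarrow> real" where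
  "laplace_correction \<epsilon> s n \<delta> = 6 * ln (real n powr s * zeta s / \<delta>) / (real n * \<epsilon>)"

text \<open>The infimum is taken in \<open>ereal\<close>, so that it is \<open>\<infinity>\<close> when no positive integer qualifies;
  the infimum of the empty set of naturals would be \<open>0\<close>. The noise enters only through the
  correction function \<open>C\<close>.\<close>

definition dp_sprt_N ::
  "(nat \<Rightarrow> real \<Rightarrow> real) \<Rightarrow> real \<Rightarrow> real \<Rightarrow> real \<Rightarrow> real \<Rightarrow> ereal" where
  "dp_sprt_N C \<theta>0 \<theta>1 \<beta> \<gamma> =
     (INF n \<in> {n. 0 < n \<and>
        ln (1 / (\<beta> * \<gamma>)) / (real n * \<bar>\<theta>0 - \<theta>1\<bar>) + 2 * C n ((1 - \<gamma>) * \<beta>)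
          \<le> KL (bernoulli_nat_param \<theta>0) (bernoulli_nat_param \<theta>1) / (2 * \<bar>\<theta>0 - \<theta>1\<bar>)}.
      ereal (real n))"

end

theory Submission
  imports Defs "HOL-Real_Asymp.Real_Asymp"
begin

text \<open>Write \<open>A \<beta>\<close> for the sum of the two main terms, \<open>D = \<theta>1 - \<theta>0\<close> and \<open>c = 24 D s / (\<epsilon> KL)\<close>.
  Clearing denominators, a positive \<open>n\<close> belongs to the set defining \<open>N\<close> iff \<open>A \<beta> + c ln n \<le> n\<close>.
  Since \<open>A \<beta> \<rightarrow> \<infinity>\<close>, the integer \<open>n = \<lceil>A \<beta> + c ln (2 A \<beta>)\<rceil>\<close> is at most \<open>2 A \<beta>\<close> for small \<open>\<beta>\<close> and
  therefore qualifies. It exceeds \<open>A \<beta>\<close> by at most \<open>c ln (2 A \<beta>) + 1\<close>, which is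
  \<open>o(ln (1/\<beta>))\<close> because \<open>A \<beta>\<close> is affine in \<open>ln (1/\<beta>)\<close>.\<close>

lemma zeta_pos:
  assumes "s > 1"
  shows "zeta s > 0"
  unfolding zeta_def
proof (rule suminf_pos)
  have "summable (\<lambda>n. real n powr (-s))"
    using assms by (subst summable_real_powr_iff) auto
  then have "summable (\<lambda>n. real (Suc n) powr (-s))"
    by (subst summable_Suc_iff)
  then show "summable (\<lambda>n. 1 / real (Suc n) powr s)"
    by (simp add: powr_minus divide_inverse)
qed simp

text \<open>Gibbs' inequality in its strict form: the support inclusion makes \<open>?D\<close> a
  density of \<open>p\<close> with respect to \<open>q\<close>, and the finite support of
  \<open>q\<close> makes the integrand of the divergence integrable.\<close>

lemma KL_pos:
  assumes "finite (set_pmf q)" and subset: "set_pmf p \<subseteq> set_pmf q" and "p \<noteq> q"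
  shows "KL p q > 0"
proof -
  let ?D = "\<lambda>x. pmf p x / pmf q x"
  interpret information_space "measure_pmf q" "exp 1"
    by unfold_locales (simp add: one_less_exp_iff)
  \<comment> \<open>Where \<open>pmf q x = 0\<close> the quotient is 0 by convention;
    \<open>subset\<close> forces \<open>pmf p x = 0\<close> there, so no mass is lost.\<close>
  have eq: "density (measure_pmf q) ?D = measure_pmf p"
    unfolding measure_pmf_eq_density[of q] measure_pmf_eq_density[of p] using subset
    by (subst density_density_divide) (auto simp: AE_count_space set_pmf_eq)
  have "0 < KL_divergence (exp 1) (measure_pmf q) (density (measure_pmf q) ?D)"
  proof (rule KL_gt_0)
    show "prob_space (density (measure_pmf q) ?D)"
      unfolding eq by (rule measure_pmf.prob_space_axioms)
    show "integrable (measure_pmf q) (\<lambda>x. ?D x * log (exp 1) (?D x))"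
      by (rule integrable_measure_pmf_finite) fact
    show "density (measure_pmf q) ?D \<noteq> measure_pmf q"
      unfolding eq using \<open>p \<noteq> q\<close> by (simp add: measure_pmf_inject)
  qed auto
  then show ?thesis
    unfolding KL_def eq .
qed

lemma bernoulli_nat_param_pmf_True:
  "pmf (bernoulli_nat_param \<theta>) True = exp \<theta> / (1 + exp \<theta>)"
  unfolding bernoulli_nat_param_def
  by (subst pmf_bernoulli_True) (auto simp: divide_simps add_pos_pos)

lemma set_pmf_bernoulli_nat_param: "set_pmf (bernoulli_nat_param \<theta>) = UNIV"
proof -
  have "0 < exp \<theta> / (1 + exp \<theta>)" "exp \<theta> / (1 + exp \<theta>) < 1"
    by (auto simp: divide_simps add_pos_pos)
  then show ?thesis
    unfolding bernoulli_nat_param_def by (rule set_pmf_bernoulli)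
qed

lemma inj_bernoulli_nat_param: "inj bernoulli_nat_param"
proof (rule injI)
  fix x y assume "bernoulli_nat_param x = bernoulli_nat_param y"
  then have "exp x / (1 + exp x) = exp y / (1 + exp y)"
    by (metis bernoulli_nat_param_pmf_True)
  moreover have "1 + exp x > 0" "1 + exp y > 0"
    by (simp_all add: add_pos_pos)
  ultimately show "x = y"
    by (simp add: field_simps)
qed

text \<open>The logistic function is injective, so distinct parameters give distinct distributions.
  Every later division by the divergence rests on this.\<close>

lemma KL_bernoulli_nat_param_pos:
  "\<theta>0 \<noteq> \<theta>1 \<Longrightarrow> KL (bernoulli_nat_param \<theta>0) (bernoulli_nat_param \<theta>1) > 0"
  using inj_bernoulli_nat_param
  by (intro KL_pos) (auto simp: set_pmf_bernoulli_nat_param inj_eq)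

text \<open>The logarithm of \<open>real n powr s\<close> in the correction splits off
  \<open>s * ln (real n)\<close>, which becomes the last summand of the hypothesis; the other two
  summands are free of \<open>n\<close>.\<close>

lemma dp_sprt_N_le:
  fixes \<theta>0 \<theta>1 \<epsilon> \<gamma> s \<beta> :: real and n :: nat
  defines "K \<equiv> KL (bernoulli_nat_param \<theta>0) (bernoulli_nat_param \<theta>1)"
  assumes "\<theta>0 < \<theta>1" "\<epsilon> > 0" "\<gamma> < 1" "s > 1" "\<beta> > 0" "n > 0"
    and n: "24 * (\<theta>1 - \<theta>0) * ln (zeta s / ((1 - \<gamma>) * \<beta>)) / (\<epsilon> * K) + 2 * ln (1 / (\<gamma> * \<beta>)) / K
            + 24 * (\<theta>1 - \<theta>0) * s / (\<epsilon> * K) * ln (real n) \<le> real n"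
  shows "dp_sprt_N (laplace_correction \<epsilon> s) \<theta>0 \<theta>1 \<beta> \<gamma> \<le> ereal (real n)"
proof -
  define D where "D = \<theta>1 - \<theta>0"
  define L1 where "L1 = ln (1 / (\<gamma> * \<beta>))"
  define L2 where "L2 = ln (zeta s / ((1 - \<gamma>) * \<beta>))"
  have pos: "D > 0" "K > 0" "real n > 0"
    using assms KL_bernoulli_nat_param_pos[of \<theta>0 \<theta>1] by (auto simp: D_def K_def)
  have "zeta s / ((1 - \<gamma>) * \<beta>) > 0"
    using assms zeta_pos by simp
  then have "ln (real n powr s * (zeta s / ((1 - \<gamma>) * \<beta>))) = s * ln (real n) + L2"
    using pos by (subst ln_mult) (auto simp: L2_def ln_powr)
  then have C: "laplace_correction \<epsilon> s n ((1 - \<gamma>) * \<beta>)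
      = 6 * (s * ln (real n) + L2) / (real n * \<epsilon>)"
    by (simp add: laplace_correction_def)
  \<comment> \<open>The factor \<open>K / (2 * D * real n)\<close> is positive and turns the bound
    \<open>real n\<close> into the threshold \<open>K / (2 * D)\<close>.\<close>
  have "L1 / (real n * D) + 2 * (6 * (s * ln (real n) + L2) / (real n * \<epsilon>))
      = K / (2 * D * real n) *
        (24 * D * L2 / (\<epsilon> * K) + 2 * L1 / K + 24 * D * s / (\<epsilon> * K) * ln (real n))"
    using pos \<open>\<epsilon> > 0\<close> by (simp add: field_simps)
  also have "\<dots> \<le> K / (2 * D * real n) * real n"
    using n pos by (intro mult_left_mono) (auto simp: D_def L1_def L2_def)
  also have "\<dots> = K / (2 * D)"
    using pos by simp
  finally have "ln (1 / (\<beta> * \<gamma>)) / (real n * \<bar>\<theta>0 - \<theta>1\<bar>)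
      + 2 * laplace_correction \<epsilon> s n ((1 - \<gamma>) * \<beta>) \<le> K / (2 * \<bar>\<theta>0 - \<theta>1\<bar>)"
    unfolding C using \<open>\<theta>0 < \<theta>1\<close> by (simp add: D_def L1_def mult.commute)
  then show ?thesis
    unfolding dp_sprt_N_def using \<open>n > 0\<close> by (intro INF_lower) (simp add: K_def)
qed

theorem corollary1:
  fixes \<theta>0 \<theta>1 \<epsilon> \<gamma> s :: real
  assumes "\<theta>0 < \<theta>1" and "\<epsilon> > 0" and "0 < \<gamma>" and "\<gamma> < 1" and "s > 1"
  shows "\<exists>r :: real \<Rightarrow> real. r \<in> o[at_right 0](\<lambda>\<beta>. ln (1 / \<beta>)) \<and>
    (\<forall>\<^sub>F \<beta> in at_right 0.
       dp_sprt_N (laplace_correction \<epsilon> s) \<theta>0 \<theta>1 \<beta> \<gamma>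
         \<le> ereal (24 * (\<theta>1 - \<theta>0) * ln (zeta s / ((1 - \<gamma>) * \<beta>))
                    / (\<epsilon> * KL (bernoulli_nat_param \<theta>0) (bernoulli_nat_param \<theta>1))
                + 2 * ln (1 / (\<gamma> * \<beta>))
                    / KL (bernoulli_nat_param \<theta>0) (bernoulli_nat_param \<theta>1)
                + r \<beta>))"
proof -
  define K where "K = KL (bernoulli_nat_param \<theta>0) (bernoulli_nat_param \<theta>1)"
  define a where "a = 24 * (\<theta>1 - \<theta>0) / (\<epsilon> * K)"
  define c where "c = a * s"
  \<comment> \<open>\<open>p\<close> and \<open>q\<close> are the slope and the intercept of
    \<open>A \<beta>\<close> as a function of \<open>ln (1 / \<beta>)\<close>.\<close>
  define p where "p = a + 2 / K"
  define q where "q = a * ln (zeta s / (1 - \<gamma>)) + 2 / K * ln (1 / \<gamma>)"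
  have "K > 0"
    unfolding K_def using assms by (intro KL_bernoulli_nat_param_pos) simp
  then have "a > 0" and "p > 0" and "c > 0"
    using assms by (auto simp: a_def p_def c_def intro!: add_pos_pos)
  define A where "A \<beta> = 24 * (\<theta>1 - \<theta>0) * ln (zeta s / ((1 - \<gamma>) * \<beta>)) / (\<epsilon> * K)
    + 2 * ln (1 / (\<gamma> * \<beta>)) / K" for \<beta>
  \<comment> \<open>The summand 1 pays for rounding up to an integer. The affine form in place of
    \<open>A \<beta>\<close> makes \<open>r\<close> a function of \<open>ln (1 / \<beta>)\<close>
    alone, so its growth can be studied in \<open>L = ln (1 / \<beta>)\<close> and carried over
    along \<open>lim\<close>.\<close>
  define r where "r \<beta> = c * ln (2 * (p * ln (1 / \<beta>) + q)) + 1" for \<beta>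

  have A_eq: "A \<beta> = p * ln (1 / \<beta>) + q" if "\<beta> > 0" for \<beta>
  proof -
    have "ln (zeta s / ((1 - \<gamma>) * \<beta>)) = ln (zeta s / (1 - \<gamma>)) + ln (1 / \<beta>)"
      using that assms zeta_pos[OF \<open>s > 1\<close>] by (subst ln_mult_pos[symmetric]) auto
    moreover have "ln (1 / (\<gamma> * \<beta>)) = ln (1 / \<gamma>) + ln (1 / \<beta>)"
      using that assms by (subst ln_mult_pos[symmetric]) auto
    moreover have "A \<beta> = a * ln (zeta s / ((1 - \<gamma>) * \<beta>)) + 2 / K * ln (1 / (\<gamma> * \<beta>))"
      by (simp add: A_def a_def)
    ultimately show ?thesis
      by (simp only: p_def q_def distrib_left distrib_right ac_simps)
  qed
  have lim: "filterlim (\<lambda>\<beta>::real. ln (1 / \<beta>)) at_top (at_right 0)"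
    by real_asymp

  have "(\<lambda>L. c * ln (2 * (p * L + q)) + 1) \<in> o[at_top](\<lambda>L. L)"
    using \<open>p > 0\<close> by real_asymp
  from landau_o.small.compose[OF this lim] have "r \<in> o[at_right 0](\<lambda>\<beta>. ln (1 / \<beta>))"
    unfolding r_def[abs_def] .
  moreover
  \<comment> \<open>The first bound keeps \<open>ln (2 * A \<beta>)\<close> nonnegative, so the
    number to be rounded is positive; the second keeps the rounded number below
    \<open>2 * A \<beta>\<close>.\<close>
  have "eventually (\<lambda>L. p * L + q \<ge> 1 \<and>
      p * L + q + c * ln (2 * (p * L + q)) + 1 \<le> 2 * (p * L + q)) at_top"
    using \<open>p > 0\<close> by (intro eventually_conj; real_asymp)
  then have ev: "\<forall>\<^sub>F \<beta> in at_right 0. p * ln (1 / \<beta>) + q \<ge> 1 \<and>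
      p * ln (1 / \<beta>) + q + c * ln (2 * (p * ln (1 / \<beta>) + q)) + 1 \<le> 2 * (p * ln (1 / \<beta>) + q)"
    using lim by (rule eventually_compose_filterlim)
  have "\<forall>\<^sub>F \<beta> in at_right 0.
    dp_sprt_N (laplace_correction \<epsilon> s) \<theta>0 \<theta>1 \<beta> \<gamma> \<le> ereal (A \<beta> + r \<beta>)"
    using ev eventually_at_right_less[of 0]
  proof eventually_elim
    case (elim \<beta>)
    define x where "x = A \<beta> + c * ln (2 * A \<beta>)"
    have "A \<beta> \<ge> 1" "x + 1 \<le> 2 * A \<beta>" and r: "r \<beta> = c * ln (2 * A \<beta>) + 1"
      using elim A_eq[of \<beta>] by (auto simp: x_def r_def)
    have "x > 0"
      using \<open>A \<beta> \<ge> 1\<close> \<open>c > 0\<close> by (auto simp: x_def intro!: add_pos_nonneg mult_nonneg_nonneg)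
    define n where "n = nat \<lceil>x\<rceil>"
    have n: "x \<le> real n" "real n \<le> x + 1" "n > 0"
      using \<open>x > 0\<close> by (auto simp: n_def; linarith)+
    \<comment> \<open>This removes the circularity: \<open>ln (real n)\<close> is bounded by the
      term already built into \<open>x\<close>, since \<open>real n\<close> is at most
      \<open>x + 1\<close>.\<close>
    have "c * ln (real n) \<le> c * ln (2 * A \<beta>)"
      using n \<open>c > 0\<close> \<open>x + 1 \<le> 2 * A \<beta>\<close> by (intro mult_left_mono) auto
    then have "A \<beta> + c * ln (real n) \<le> real n"
      using n(1) by (simp add: x_def)
    then have "dp_sprt_N (laplace_correction \<epsilon> s) \<theta>0 \<theta>1 \<beta> \<gamma> \<le> ereal (real n)"
      using elim assms n(3) by (intro dp_sprt_N_le) (auto simp: A_def c_def a_def K_def)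
    also have "\<dots> \<le> ereal (A \<beta> + r \<beta>)"
      using n(2) by (simp add: x_def r)
    finally show ?case .
  qed
  ultimately show ?thesis
    unfolding A_def K_def by blast
qed

end
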